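(* Let $0<\alpha<\tfrac12$ be irrational and $\rho=1-\alpha$ (so that $(s_{\alpha,\rho},s'_{\alpha,\rho})$ is the lozenge pair with index $1$), and suppose $s_{\alpha,\rho}$ and $s'_{\alpha,\rho}$ are substitution invariant. Then $s_{\alpha,\rho}$ and $s'_{\alpha,\rho}$ are fixed points of $\psi^2$ for some $\psi\in\mathcal{M}_{2,4}\setminus\mathcal{M}_4$; namely, this holds for $\psi\in\mathcal{M}_{2,4}\setminus\mathcal{M}_4$ such that its time reversal satisfies $\widetilde{\psi}(c_\alpha)=c_\alpha$.
   Context: For irrational $0<\alpha<1$ and real $\rho$: $s_{\alpha,\rho}(n)=\lfloor (n+1)\alpha+\rho\rfloor-\lfloor n\alpha+\rho\rfloor$, $s'_{\alpha,\rho}(n)=\lceil (n+1)\alpha+\rho\rceil-\lceil n\alpha+\rho\rceil$, $n\ge0$, and $c_\alpha=s_{\alpha,\alpha}$. A word is substitution invariant if it is a fixed point of a morphism of $\{0,1\}^*$ other than the identity. Morphisms: $\psi_1: 0\mapsto 01,\ 1\mapsto 0$; $\psi_2: 0\mapsto 10,\ 1\mapsto 0$; $\psi_3: 0\mapsto 0,\ 1\mapsto 01$; $\psi_4: 0\mapsto 0,\ 1\mapsto 10$. $\mathcal{M}_{2,4}$ is the monoid under composition generated by $\psi_2,\psi_4$, and $\mathcal{M}_4=\{\psi_4^n:n\ge0\}$. The time reversal $\widetilde{\sigma}$ of a morphism $\sigma$ is the morphism with $\widetilde{\sigma}(a)$ equal to the reversal of the word $\sigma(a)$ for $a\in\{0,1\}$;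 thus $\widetilde{\psi}_1=\psi_2$, $\widetilde{\psi}_3=\psi_4$, and $\widetilde{\sigma\tau}=\widetilde{\sigma}\widetilde{\tau}$. *)

theory Defs
  imports Complex_Main "HOL-Library.Z2"
begin

text \<open>The alphabet {0,1} is the two-element type \<open>bit\<close>; finite words are
  lists, and infinite words are functions on \<open>nat\<close>.\<close>

type_synonym word = "bit list"
type_synonym infword = "nat \<Rightarrow> bit"

text \<open>The differences below are 0 or 1 when \<open>0 < \<alpha> < 1\<close> (lemmas
  \<open>sturm_letter\<close> and \<open>sturm'_letter\<close>), so reading them in
  \<open>bit\<close> loses no information.\<close>

definition sturm :: "real \<Rightarrow> real \<Rightarrow> infword" where
  "sturm \<alpha> \<rho> n = of_int (\<lfloor>(real n + 1) * \<alpha> + \<rho>\<rfloor> - \<lfloor>real n * \<alpha> + \<rho>\<rfloor>)"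

definition sturm' :: "real \<Rightarrow> real \<Rightarrow> infword" where
  "sturm' \<alpha> \<rho> n = of_int (\<lceil>(real n + 1) * \<alpha> + \<rho>\<rceil> - \<lceil>real n * \<alpha> + \<rho>\<rceil>)"

definition char_word :: "real \<Rightarrow> infword" where
  "char_word \<alpha> = sturm \<alpha> \<alpha>"

lemma of_int_bit: "d \<in> {0, 1} \<Longrightarrow> d = (if (of_int d :: bit) = 1 then 1 else 0)"
  by auto

lemma sturm_letter:
  assumes "0 < \<alpha>" "\<alpha> < 1"
  shows "\<lfloor>(real n + 1) * \<alpha> + \<rho>\<rfloor> - \<lfloor>real n * \<alpha> + \<rho>\<rfloor> = (if sturm \<alpha> \<rho> n = 1 then 1 else 0)"
proof -
  have e: "(real n + 1) * \<alpha> + \<rho> = (real n * \<alpha> + \<rho>) + \<alpha>" by (simp add: algebra_simps)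
  have "\<lfloor>(real n + 1) * \<alpha> + \<rho>\<rfloor> - \<lfloor>real n * \<alpha> + \<rho>\<rfloor> \<in> {0, 1}"
    unfolding e using assms by simp linarith
  then show ?thesis unfolding sturm_def by (rule of_int_bit)
qed

lemma sturm'_letter:
  assumes "0 < \<alpha>" "\<alpha> < 1"
  shows "\<lceil>(real n + 1) * \<alpha> + \<rho>\<rceil> - \<lceil>real n * \<alpha> + \<rho>\<rceil> = (if sturm' \<alpha> \<rho> n = 1 then 1 else 0)"
proof -
  have e: "(real n + 1) * \<alpha> + \<rho> = (real n * \<alpha> + \<rho>) + \<alpha>" by (simp add: algebra_simps)
  have "\<lceil>(real n + 1) * \<alpha> + \<rho>\<rceil> - \<lceil>real n * \<alpha> + \<rho>\<rceil> \<in> {0, 1}"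
    unfolding e using assms by simp linarith
  then show ?thesis unfolding sturm'_def by (rule of_int_bit)
qed

text \<open>Monoid endomorphisms of the free monoid; erasing morphisms are allowed, and
  \<open>\<sigma> [] = []\<close> follows from the equation.\<close>

definition morphism :: "(word \<Rightarrow> word) \<Rightarrow> bool" where
  "morphism \<sigma> \<longleftrightarrow> (\<forall>u v. \<sigma> (u @ v) = \<sigma> u @ \<sigma> v)"

definition morph_of :: "word \<Rightarrow> word \<Rightarrow> word \<Rightarrow> word" where
  "morph_of u v w = concat (map (\<lambda>a. if a = 0 then u else v) w)"

definition psi2 :: "word \<Rightarrow> word" where
  "psi2 = morph_of [1, 0] [0]"

definition psi4 :: "word \<Rightarrow> word" where
  "psi4 = morph_of [0] [1, 0]"

definition time_reversal :: "(word \<Rightarrow> word) \<Rightarrow> word \<Rightarrow> word" where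
  "time_reversal \<sigma> = morph_of (rev (\<sigma> [0])) (rev (\<sigma> [1]))"

lemma time_reversal_psi2: "time_reversal psi2 = morph_of [0, 1] [0]"
  by (simp add: time_reversal_def psi2_def morph_of_def)

lemma time_reversal_psi4: "time_reversal psi4 = morph_of [0] [0, 1]"
  by (simp add: time_reversal_def psi4_def morph_of_def)

inductive_set M24 :: "(word \<Rightarrow> word) set" where
  "id \<in> M24"
| "psi2 \<in> M24"
| "psi4 \<in> M24"
| "\<sigma> \<in> M24 \<Longrightarrow> \<tau> \<in> M24 \<Longrightarrow> \<sigma> \<circ> \<tau> \<in> M24"

definition M4 :: "(word \<Rightarrow> word) set" where
  "M4 = {psi4 ^^ n | n. True}"

text \<open>\<open>inf_image \<sigma> x y\<close> says \<open>\<sigma>(x) = y\<close>: the images of the prefixes of \<open>x\<close>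
  converge to \<open>y\<close> letter by letter. It fails for every \<open>y\<close> if \<open>\<sigma>(x)\<close> is a finite
  word, which can happen for erasing \<open>\<sigma>\<close>.\<close>

definition prefix_word :: "nat \<Rightarrow> infword \<Rightarrow> word" where
  "prefix_word n x = map x [0..<n]"

definition inf_image :: "(word \<Rightarrow> word) \<Rightarrow> infword \<Rightarrow> infword \<Rightarrow> bool" where
  "inf_image \<sigma> x y \<longleftrightarrow>
     (\<forall>k. \<exists>N. \<forall>n\<ge>N. take k (\<sigma> (prefix_word n x)) = prefix_word k y)"

definition fixed_point :: "(word \<Rightarrow> word) \<Rightarrow> infword \<Rightarrow> bool" where
  "fixed_point \<sigma> x \<longleftrightarrow> inf_image \<sigma> x x"

definition substitution_invariant :: "infword \<Rightarrow> bool" where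
  "substitution_invariant x \<longleftrightarrow> (\<exists>\<sigma>. morphism \<sigma> \<and> \<sigma> \<noteq> id \<and> fixed_point \<sigma> x)"

end

theory Submission
  imports Defs
begin

text \<open>For the index considered, the two words are \<open>10c\<close> and \<open>01c\<close> with \<open>c = c\<^sub>\<alpha>\<close>. Every
  \<open>\<psi> \<in> M24\<close> is conjugate to its time reversal, and \<open>\<psi>(01)\<close>, \<open>\<psi>(10)\<close> are the conjugating
  word preceded by \<open>01\<close> and \<open>10\<close>, in one order or the other. So \<open>\<psi>\<close> either preserves
  or exchanges the beginnings \<open>01\<close> and \<open>10\<close> while applying the time reversal to the tail, and
  \<open>\<psi>\<^sup>2\<close> preserves them.

  For the existence of \<open>\<psi>\<close> put \<open>y = (1 - \<alpha>) / \<alpha> > 1\<close>. Counting letters, the incidence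
  matrix of a substitution fixing \<open>10c\<close> yields an equation \<open>A y\<^sup>2 + E y = B\<close> with
  \<open>A, B > 0\<close>, so that the conjugate of \<open>y\<close> is negative. Desubstituting \<open>c\<close> by the time
  reversal of \<open>\<psi>\<^sub>4\<close> or \<open>\<psi>\<^sub>2\<close> replaces \<open>y\<close> by \<open>y - 1\<close> (if \<open>y > 2\<close>) or by
  \<open>1 / (y - 1)\<close> (if \<open>y < 2\<close>). On the equations this is an injective map preserving the
  discriminant and both sign conditions. It therefore acts on a finite set and is purely periodic,
  and running through one period gives \<open>\<psi>\<close>.\<close>

section \<open>Images of infinite words\<close>

lemma morphism_append: "morphism \<sigma> \<Longrightarrow> \<sigma> (u @ v) = \<sigma> u @ \<sigma> v"
  by (simp add: morphism_def)

lemma morphism_Nil: "morphism \<sigma> \<Longrightarrow> \<sigma> [] = []"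
  using morphism_append[of \<sigma> "[]" "[]"] by simp

lemma morphism_Cons: "morphism \<sigma> \<Longrightarrow> \<sigma> (a # w) = \<sigma> [a] @ \<sigma> w"
  using morphism_append[of \<sigma> "[a]" w] by simp

lemma morphism_morph_of: "morphism (morph_of u v)"
  by (simp add: morphism_def morph_of_def)

lemma morphism_comp: "morphism \<sigma> \<Longrightarrow> morphism \<tau> \<Longrightarrow> morphism (\<sigma> \<circ> \<tau>)"
  by (simp add: morphism_def)

lemma length_prefix_word [simp]: "length (prefix_word n x) = n"
  by (simp add: prefix_word_def)

lemma nth_prefix_word [simp]: "i < n \<Longrightarrow> prefix_word n x ! i = x i"
  by (simp add: prefix_word_def)

lemma prefix_word_Suc: "prefix_word (Suc n) x = prefix_word n x @ [x n]"
  by (simp add: prefix_word_def)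

lemma take_prefix_word: "k \<le> n \<Longrightarrow> take k (prefix_word n x) = prefix_word k x"
  by (simp add: prefix_word_def take_map)

lemma take_eq_prefix_word_length: "take k u = prefix_word k x \<Longrightarrow> k \<le> length u"
  by (metis length_prefix_word length_take min.cobounded1)

text \<open>The first \<open>k\<close> letters of \<open>y\<close> depend only on a prefix of
  \<open>x\<close> of some length \<open>N\<close>, which \<tau> eventually produces; whatever
  follows that prefix merely appends letters under \<sigma>.\<close>

lemma inf_image_comp:
  assumes \<sigma>: "morphism \<sigma>" and xy: "inf_image \<sigma> x y" and zx: "inf_image \<tau> z x"
  shows "inf_image (\<sigma> \<circ> \<tau>) z y"
  unfolding inf_image_def
proof
  fix k
  obtain N where N: "\<And>n. n \<ge> N \<Longrightarrow> take k (\<sigma> (prefix_word n x)) = prefix_word k y"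
    using xy unfolding inf_image_def by blast
  obtain M where M: "\<And>n. n \<ge> M \<Longrightarrow> take N (\<tau> (prefix_word n z)) = prefix_word N x"
    using zx unfolding inf_image_def by blast
  have "take k ((\<sigma> \<circ> \<tau>) (prefix_word n z)) = prefix_word k y" if "n \<ge> M" for n
  proof -
    have "\<tau> (prefix_word n z) = prefix_word N x @ drop N (\<tau> (prefix_word n z))"
      using M[OF that] by (metis append_take_drop_id)
    then have *: "(\<sigma> \<circ> \<tau>) (prefix_word n z) =
        \<sigma> (prefix_word N x) @ \<sigma> (drop N (\<tau> (prefix_word n z)))"
      using morphism_append[OF \<sigma>] by (metis comp_apply)
    have t: "take k (\<sigma> (prefix_word N x)) = prefix_word k y" using N by blast
    then have "k \<le> length (\<sigma> (prefix_word N x))" by (rule take_eq_prefix_word_length)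
    with * t show ?thesis by simp
  qed
  then show "\<exists>M. \<forall>n\<ge>M. take k ((\<sigma> \<circ> \<tau>) (prefix_word n z)) = prefix_word k y" by blast
qed

text \<open>Lengthening a prefix only appends letters to its image, and images of long prefixes
  agree with \<open>y\<close> as far as required.\<close>

lemma inf_image_prefix_word:
  assumes \<sigma>: "morphism \<sigma>" and xy: "inf_image \<sigma> x y"
  shows "\<sigma> (prefix_word n x) = prefix_word (length (\<sigma> (prefix_word n x))) y"
proof -
  let ?k = "length (\<sigma> (prefix_word n x))"
  obtain N where N: "\<And>m. m \<ge> N \<Longrightarrow> take ?k (\<sigma> (prefix_word m x)) = prefix_word ?k y"
    using xy unfolding inf_image_def by blast
  define m where "m = max N n"
  have "prefix_word m x = prefix_word n x @ drop n (prefix_word m x)"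
    using take_prefix_word[of n m x] by (metis append_take_drop_id m_def max.cobounded2)
  then have "\<sigma> (prefix_word m x) = \<sigma> (prefix_word n x) @ \<sigma> (drop n (prefix_word m x))"
    using morphism_append[OF \<sigma>] by metis
  then have "take ?k (\<sigma> (prefix_word m x)) = \<sigma> (prefix_word n x)" by simp
  with N[of m] show ?thesis by (simp add: m_def)
qed

lemma inf_imageI_prefix:
  assumes "\<And>n. \<sigma> (prefix_word n x) = prefix_word (L n) y" and "\<And>n. n \<le> L n"
  shows "inf_image \<sigma> x y"
  unfolding inf_image_def
proof
  fix k
  have "take k (\<sigma> (prefix_word n x)) = prefix_word k y" if "n \<ge> k" for n
    unfolding assms(1) by (rule take_prefix_word) (use that assms(2)[of n] in linarith)
  then show "\<exists>N. \<forall>n\<ge>N. take k (\<sigma> (prefix_word n x)) = prefix_word k y" by blast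
qed

section \<open>Time reversal\<close>

lemma time_reversal_eq: "morphism \<sigma> \<Longrightarrow> time_reversal \<sigma> w = rev (\<sigma> (rev w))"
proof (induction w)
  case Nil
  then show ?case by (simp add: time_reversal_def morph_of_def morphism_Nil)
next
  case (Cons a w)
  have "time_reversal \<sigma> (a # w) = rev (\<sigma> [a]) @ time_reversal \<sigma> w"
    by (cases a) (simp_all add: time_reversal_def morph_of_def)
  then show ?case using Cons by (simp add: morphism_append)
qed

lemma time_reversal_id: "time_reversal id = id"
  by (rule ext, subst time_reversal_eq) (simp_all add: morphism_def)

lemma morphism_time_reversal: "morphism (time_reversal \<sigma>)"
  by (simp add: time_reversal_def morphism_morph_of)

lemma time_reversal_comp:
  assumes "morphism \<sigma>" "morphism \<tau>"
  shows "time_reversal (\<sigma> \<circ> \<tau>) = time_reversal \<sigma> \<circ> time_reversal \<tau>"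
  using assms by (simp add: fun_eq_iff time_reversal_eq morphism_comp)

lemma M24_morphism: "\<psi> \<in> M24 \<Longrightarrow> morphism \<psi>"
proof (induction rule: M24.induct)
  case 1
  then show ?case by (simp add: morphism_def)
next
  case (4 \<sigma> \<tau>)
  then show ?case by (intro morphism_comp)
qed (simp_all add: psi2_def psi4_def morphism_morph_of)

text \<open>Among the generators \<open>psi4\<close> keeps the order of \<open>01\<close> and
  \<open>10\<close> and \<open>psi2\<close> exchanges it, both with conjugating word
  \<open>0\<close>. The two options for \<open>(p, q)\<close> record this parity.\<close>

lemma M24_conjugate:
  assumes "\<psi> \<in> M24"
  shows "\<exists>u p q. (p, q) \<in> {([0,1], [1,0]), ([1,0], [0,1])} \<and> \<psi> [0,1] = p @ u \<and> \<psi> [1,0] = q @ u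
    \<and> (\<forall>w. time_reversal \<psi> w @ u = u @ \<psi> w)"
  using assms
proof (induction rule: M24.induct)
  case 1
  show ?case
    by (rule exI[of _ "[]"], rule exI[of _ "[0,1]"], rule exI[of _ "[1,0]"]) 
      (simp add: time_reversal_id[unfolded id_def])
next
  case 2
  have "time_reversal psi2 w @ [0] = [0] @ psi2 w" for w
    unfolding time_reversal_psi2 by (induction w) (simp_all add: psi2_def morph_of_def)
  moreover have "psi2 [0,1] = [1,0,0]" "psi2 [1,0] = [0,1,0]" by (simp_all add: psi2_def morph_of_def)
  ultimately show ?case by (intro exI[of _ "[0]"] exI[of _ "[1,0]"] exI[of _ "[0,1]"]) simp
next
  case 3
  have "time_reversal psi4 w @ [0] = [0] @ psi4 w" for w
    unfolding time_reversal_psi4 by (induction w) (simp_all add: psi4_def morph_of_def)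
  moreover have "psi4 [0,1] = [0,1,0]" "psi4 [1,0] = [1,0,0]" by (simp_all add: psi4_def morph_of_def)
  ultimately show ?case by (intro exI[of _ "[0]"] exI[of _ "[0,1]"] exI[of _ "[1,0]"]) simp
next
  case (4 \<sigma> \<tau>)
  from 4 have m: "morphism \<sigma>" "morphism \<tau>" by (simp_all add: M24_morphism)
  from 4 obtain u p q where \<sigma>: "(p, q) \<in> {([0,1], [1,0]), ([1,0], [0,1])}" "\<sigma> [0,1] = p @ u"
    "\<sigma> [1,0] = q @ u" "\<And>w. time_reversal \<sigma> w @ u = u @ \<sigma> w" by blast
  from 4 obtain v r s where \<tau>: "(r, s) \<in> {([0,1], [1,0]), ([1,0], [0,1])}" "\<tau> [0,1] = r @ v"
    "\<tau> [1,0] = s @ v" "\<And>w. time_reversal \<tau> w @ v = v @ \<tau> w" by blast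
  \<comment> \<open>Moving \<open>v\<close> past \<open>\<tau> w\<close> inside the reversal of
    \<sigma>, and then \<open>u\<close> past the result, leaves \<open>u @ \<sigma> v\<close> in
    front.\<close>
  let ?u = "u @ \<sigma> v"
  have conj: "time_reversal (\<sigma> \<circ> \<tau>) w @ ?u = ?u @ (\<sigma> \<circ> \<tau>) w" for w
  proof -
    have "time_reversal (\<sigma> \<circ> \<tau>) w @ ?u = time_reversal \<sigma> (time_reversal \<tau> w) @ time_reversal \<sigma> v @ u"
      using \<sigma>(4) m by (simp add: time_reversal_comp)
    also have "\<dots> = time_reversal \<sigma> (v @ \<tau> w) @ u"
      by (metis \<tau>(4) append_assoc morphism_append morphism_time_reversal)
    also have "\<dots> = ?u @ (\<sigma> \<circ> \<tau>) w" using \<sigma>(4) m by (simp add: morphism_append)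
    finally show ?thesis .
  qed
  have "(\<sigma> \<circ> \<tau>) [0,1] = \<sigma> r @ \<sigma> v" "(\<sigma> \<circ> \<tau>) [1,0] = \<sigma> s @ \<sigma> v"
    using \<tau> m by (simp_all add: morphism_append)
  moreover have "\<sigma> r = p @ u \<and> \<sigma> s = q @ u \<or> \<sigma> r = q @ u \<and> \<sigma> s = p @ u"
    using \<sigma> \<tau> by auto
  ultimately consider "(\<sigma> \<circ> \<tau>) [0,1] = p @ ?u" "(\<sigma> \<circ> \<tau>) [1,0] = q @ ?u"
    | "(\<sigma> \<circ> \<tau>) [0,1] = q @ ?u" "(\<sigma> \<circ> \<tau>) [1,0] = p @ ?u" by force
  then show ?case
  proof cases
    case 1
    then show ?thesis using \<sigma>(1) conj by blast
  next
    case 2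
    then show ?thesis using \<sigma>(1) conj by blast
  qed
qed

section \<open>Transfer of fixed points from c to 01c and 10c\<close>

definition prepend2 :: "bit \<Rightarrow> bit \<Rightarrow> infword \<Rightarrow> infword" where
  "prepend2 a b x n = (if n = 0 then a else if n = 1 then b else x (n - 2))"

lemma prefix_word_prepend2: "prefix_word (n + 2) (prepend2 a b x) = a # b # prefix_word n x"
  by (rule nth_equalityI) (auto simp: prepend2_def nth_Cons split: nat.splits)

text \<open>The image of \<open>abx\<close> is \<open>a'b'u\<close> followed by the image of
  \<open>x\<close>. On each prefix, conjugation pushes \<open>u\<close> to the end, so it disappears
  in the limit.\<close>

lemma inf_image_prepend2:
  assumes \<psi>: "morphism \<psi>" and p: "\<psi> [a, b] = [a', b'] @ u"
    and conj: "\<And>w. time_reversal \<psi> w @ u = u @ \<psi> w"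
    and xy: "inf_image (time_reversal \<psi>) x y"
  shows "inf_image \<psi> (prepend2 a b x) (prepend2 a' b' y)"
  unfolding inf_image_def
proof
  fix k
  obtain N where N: "\<And>n. n \<ge> N \<Longrightarrow> take k (time_reversal \<psi> (prefix_word n x)) = prefix_word k y"
    using xy unfolding inf_image_def by blast
  have "take k (\<psi> (prefix_word n (prepend2 a b x))) = prefix_word k (prepend2 a' b' y)"
    if "n \<ge> N + 2" for n
  proof -
    define m where "m = n - 2"
    have m: "n = m + 2" "m \<ge> N" using that by (simp_all add: m_def)
    let ?v = "time_reversal \<psi> (prefix_word m x)"
    have t: "take k ?v = prefix_word k y" using N m by blast
    then have k: "k \<le> length ?v" by (rule take_eq_prefix_word_length)
    have "\<psi> (prefix_word n (prepend2 a b x)) = \<psi> [a, b] @ \<psi> (prefix_word m x)"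
      unfolding m prefix_word_prepend2 using morphism_append[OF \<psi>, of "[a, b]" "prefix_word m x"] by simp
    also have "\<dots> = [a', b'] @ ?v @ u" using p conj by simp
    \<comment> \<open>The cut does not reach the trailing \<open>u\<close>, since \<open>?v\<close>
      has at least \<open>k\<close> letters.\<close>
    finally have "take (k + 2) (\<psi> (prefix_word n (prepend2 a b x))) = a' # b' # take k ?v"
      using k by simp
    also have "\<dots> = prefix_word (k + 2) (prepend2 a' b' y)" by (simp only: t prefix_word_prepend2)
    finally have "take k (take (k + 2) (\<psi> (prefix_word n (prepend2 a b x)))) =
        take k (prefix_word (k + 2) (prepend2 a' b' y))" by (rule arg_cong)
    then show ?thesis by (simp add: take_prefix_word min_def)
  qed
  then show "\<exists>N. \<forall>n\<ge>N. take k (\<psi> (prefix_word n (prepend2 a b x))) = prefix_word k (prepend2 a' b' y)"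
    by blast
qed

lemma M24_square_fixed_point:
  assumes "\<psi> \<in> M24" and "fixed_point (time_reversal \<psi>) x"
  shows "fixed_point (\<psi> ^^ 2) (prepend2 0 1 x)" "fixed_point (\<psi> ^^ 2) (prepend2 1 0 x)"
proof -
  have m: "morphism \<psi>" using assms M24_morphism by blast
  obtain u p q where u: "(p, q) \<in> {([0,1], [1,0]), ([1,0], [0,1])}" "\<psi> [0,1] = p @ u"
    "\<psi> [1,0] = q @ u" "\<And>w. time_reversal \<psi> w @ u = u @ \<psi> w"
    using M24_conjugate[OF assms(1)] by blast
  have sq: "\<psi> ^^ 2 = \<psi> \<circ> \<psi>" by (simp add: numeral_2_eq_2)
  note img = inf_image_prepend2[OF m _ u(4) assms(2)[unfolded fixed_point_def]]
  consider "p = [0,1]" "q = [1,0]" | "p = [1,0]" "q = [0,1]" using u(1) by auto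
  then have "inf_image \<psi> (prepend2 0 1 x) (prepend2 0 1 x) \<and> inf_image \<psi> (prepend2 1 0 x) (prepend2 1 0 x)
    \<or> inf_image \<psi> (prepend2 0 1 x) (prepend2 1 0 x) \<and> inf_image \<psi> (prepend2 1 0 x) (prepend2 0 1 x)"
    by cases (use u(2,3) img in auto)
  then show "fixed_point (\<psi> ^^ 2) (prepend2 0 1 x)" "fixed_point (\<psi> ^^ 2) (prepend2 1 0 x)"
    unfolding fixed_point_def sq by (auto intro: inf_image_comp[OF m])
qed

section \<open>Desubstitution of characteristic words\<close>

lemma char_word_eq: "char_word \<alpha> n = of_int (\<lfloor>real (n + 2) * \<alpha>\<rfloor> - \<lfloor>real (n + 1) * \<alpha>\<rfloor>)"
  by (simp add: char_word_def sturm_def algebra_simps)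

lemma sturm_lozenge:
  assumes "0 < \<alpha>" "\<alpha> < 1"
  shows "sturm \<alpha> (1 - \<alpha>) = prepend2 1 0 (char_word \<alpha>)"
proof
  fix n
  show "sturm \<alpha> (1 - \<alpha>) n = prepend2 1 0 (char_word \<alpha>) n"
  proof (cases "n < 2")
    case True
    have "\<lfloor>1 - \<alpha>\<rfloor> = 0" "\<lfloor>1 + \<alpha>\<rfloor> = 1" using assms by (simp_all add: floor_eq_iff)
    with True show ?thesis
      by (auto simp: sturm_def prepend2_def less_2_cases_iff algebra_simps)
  next
    case False
    then obtain m where m: "n = m + 2" by (metis add.commute le_Suc_ex not_less)
    have e: "(real n + 1) * \<alpha> + (1 - \<alpha>) = real (m + 2) * \<alpha> + 1"
      "real n * \<alpha> + (1 - \<alpha>) = real (m + 1) * \<alpha> + 1" by (simp_all add: m algebra_simps)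
    show ?thesis unfolding sturm_def e by (simp add: prepend2_def char_word_eq m)
  qed
qed

lemma not_Rats_mult_ne_int: "(\<alpha>::real) \<notin> \<rat> \<Longrightarrow> n \<noteq> 0 \<Longrightarrow> real n * \<alpha> \<noteq> of_int k"
proof
  assume "\<alpha> \<notin> \<rat>" "n \<noteq> 0" "real n * \<alpha> = of_int k"
  then have "\<alpha> = of_int k / of_nat n" by (simp add: field_simps)
  then show False using \<open>\<alpha> \<notin> \<rat>\<close> by simp
qed

lemma ceiling_mult_not_Rats:
  assumes "(\<alpha>::real) \<notin> \<rat>" "n \<noteq> 0"
  shows "\<lceil>real n * \<alpha>\<rceil> = \<lfloor>real n * \<alpha>\<rfloor> + 1"
proof -
  have "real n * \<alpha> \<noteq> of_int \<lfloor>real n * \<alpha>\<rfloor>" by (rule not_Rats_mult_ne_int[OF assms])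
  then show ?thesis by linarith
qed

text \<open>At n = 1 the argument is the integer 1, where floor and ceiling agree; at every other n
  irrationality puts the ceiling one above the floor. So, compared with the floor word, only the
  first two letters are exchanged.\<close>

lemma sturm'_lozenge:
  assumes "0 < \<alpha>" "\<alpha> < 1" "\<alpha> \<notin> \<rat>"
  shows "sturm' \<alpha> (1 - \<alpha>) = prepend2 0 1 (char_word \<alpha>)"
proof
  fix n
  show "sturm' \<alpha> (1 - \<alpha>) n = prepend2 0 1 (char_word \<alpha>) n"
  proof (cases "n < 2")
    case True
    have "\<lceil>1 - \<alpha>\<rceil> = 1" "\<lceil>1 + \<alpha>\<rceil> = 2" using assms by (simp_all add: ceiling_eq_iff)
    with True show ?thesis
      by (auto simp: sturm'_def prepend2_def less_2_cases_iff algebra_simps)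
  next
    case False
    then obtain m where m: "n = m + 2" by (metis add.commute le_Suc_ex not_less)
    have e: "(real n + 1) * \<alpha> + (1 - \<alpha>) = real (m + 2) * \<alpha> + 1"
      "real n * \<alpha> + (1 - \<alpha>) = real (m + 1) * \<alpha> + 1" by (simp_all add: m algebra_simps)
    have "\<lceil>real (m + 2) * \<alpha> + 1\<rceil> - \<lceil>real (m + 1) * \<alpha> + 1\<rceil> = \<lfloor>real (m + 2) * \<alpha>\<rfloor> - \<lfloor>real (m + 1) * \<alpha>\<rfloor>"
      using ceiling_mult_not_Rats[OF assms(3), of "m + 2"] ceiling_mult_not_Rats[OF assms(3), of "m + 1"]
      by (simp del: of_nat_add)
    then show ?thesis unfolding sturm'_def e by (simp add: prepend2_def char_word_eq m)
  qed
qed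

text \<open>Adding 1 in \<open>bit\<close> exchanges the letters; irrationality turns the ceiling of
  \<open>m * \<beta>\<close> into its floor plus 1.\<close>

lemma char_word_complement:
  assumes "\<beta> \<notin> \<rat>"
  shows "char_word (1 - \<beta>) n = 1 + char_word \<beta> n"
proof -
  have *: "\<lfloor>real m * (1 - \<beta>)\<rfloor> = int m - 1 - \<lfloor>real m * \<beta>\<rfloor>" if "m \<noteq> 0" for m
    using ceiling_mult_not_Rats[OF assms that] by (simp add: algebra_simps) linarith
  show ?thesis unfolding char_word_eq by (subst (1 2) *) simp_all
qed

text \<open>Clearing the denominator turns the bounds defining \<open>j\<close> into
  \<open>j \<le> (N + j) * \<alpha>\<close> and \<open>(N + j + 1) * \<alpha> < j + 1\<close>. Two
  consecutive multiples in one unit interval give a letter 0 of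
  \<open>char_word \<alpha>\<close>.\<close>

lemma floor_desubst:
  fixes \<alpha> :: real and N j :: nat
  assumes \<alpha>: "0 < \<alpha>" "\<alpha> < 1/2" and j: "int j = \<lfloor>real N * (\<alpha> / (1 - \<alpha>))\<rfloor>"
  shows "\<lfloor>real (N + j) * \<alpha>\<rfloor> = int j" "\<lfloor>real (Suc (N + j)) * \<alpha>\<rfloor> = int j"
proof -
  have "real j \<le> real N * (\<alpha> / (1 - \<alpha>))" "real N * (\<alpha> / (1 - \<alpha>)) < real j + 1"
    using j by linarith+
  then have "real j * (1 - \<alpha>) \<le> real N * \<alpha>" "real N * \<alpha> < (real j + 1) * (1 - \<alpha>)"
    using \<alpha> by (simp_all add: field_simps)
  then show "\<lfloor>real (N + j) * \<alpha>\<rfloor> = int j" "\<lfloor>real (Suc (N + j)) * \<alpha>\<rfloor> = int j"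
    unfolding floor_eq_iff using \<alpha> by (simp_all add: algebra_simps)
qed

text \<open>The image of letter \<open>n\<close> starts at index \<open>n + J (n + 1)\<close> of
  \<open>char_word \<alpha>\<close>. The letter there is always 0 (\<open>c0\<close>), and a 1
  follows if letter \<open>n\<close> is 1 (\<open>c1\<close>).\<close>

lemma char_word_psi3:
  assumes "0 < \<alpha>" "\<alpha> < 1/2"
  shows "inf_image (morph_of [0] [0,1]) (char_word (\<alpha> / (1 - \<alpha>))) (char_word \<alpha>)"
proof -
  define \<beta> where "\<beta> = \<alpha> / (1 - \<alpha>)"
  have \<beta>: "0 < \<beta>" "\<beta> < 1" using assms by (simp_all add: \<beta>_def field_simps)
  \<comment> \<open>\<open>J (n + 1)\<close> is the number of 1s among the first \<open>n\<close>
    letters of \<open>char_word \<beta>\<close>; the shift by one comes from the intercept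
    \<beta>.\<close>
  define J where "J N = nat \<lfloor>real N * \<beta>\<rfloor>" for N
  have J: "int (J N) = \<lfloor>real N * \<beta>\<rfloor>" for N
    using \<beta> by (simp add: J_def)
  note fl = floor_desubst[OF assms J[unfolded \<beta>_def]]
  have c0: "char_word \<alpha> (n + J (n + 1)) = 0" for n
  proof -
    have e: "n + J (n + 1) + 2 = Suc (n + 1 + J (n + 1))" "n + J (n + 1) + 1 = n + 1 + J (n + 1)" by simp_all
    show ?thesis unfolding char_word_eq e fl by simp
  qed
  have Jstep: "J (n + 2) = J (n + 1) + (if char_word \<beta> n = 1 then 1 else 0)" for n
  proof -
    have e: "(real n + 1) * \<beta> + \<beta> = real (n + 2) * \<beta>" "real n * \<beta> + \<beta> = real (n + 1) * \<beta>"
      by (simp_all add: algebra_simps)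
    show ?thesis using sturm_letter[OF \<beta>, of n \<beta>] unfolding e J[symmetric] char_word_def by (simp split: if_splits)
  qed
  have c1: "char_word \<alpha> (n + J (n + 1) + 1) = 1" if "char_word \<beta> n = 1" for n
  proof -
    \<comment> \<open>The two multiples are the last in the unit interval belonging to
      \<open>N = n + 1\<close> and the first in the next one, belonging to
      \<open>N = n + 2\<close>.\<close>
    have e: "n + J (n + 1) + 1 + 2 = n + 2 + J (n + 2)" "n + J (n + 1) + 1 + 1 = Suc (n + 1 + J (n + 1))"
      using Jstep[of n] that by simp_all
    show ?thesis unfolding char_word_eq e fl using Jstep[of n] that by simp
  qed
  have "J 1 = 0" using \<beta> by (simp add: J_def floor_eq_iff)
  have "morph_of [0] [0,1] (prefix_word n (char_word \<beta>)) = prefix_word (n + J (n + 1)) (char_word \<alpha>)" for n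
  proof (induction n)
    case 0
    then show ?case using \<open>J 1 = 0\<close> by (simp add: prefix_word_def morph_of_def)
  next
    case (Suc n)
    have st: "morph_of [0] [0,1] (prefix_word (Suc n) (char_word \<beta>)) =
        prefix_word (n + J (n + 1)) (char_word \<alpha>) @ (if char_word \<beta> n = 0 then [0] else [0,1])"
      using Suc by (simp add: prefix_word_Suc morph_of_def)
    show ?case
      unfolding st using Jstep[of n] c0[of n] c1[of n] by (cases "char_word \<beta> n") (simp_all add: prefix_word_Suc)
  qed
  then show ?thesis unfolding \<beta>_def by (rule inf_imageI_prefix) simp
qed

text \<open>Exchanging the letters of the argument turns one morphism into the other, and on
  characteristic words this exchange replaces the slope by its complement to 1.\<close>

lemma char_word_psi1:
  assumes "0 < \<alpha>" "\<alpha> < 1/2" "\<alpha> / (1 - \<alpha>) \<notin> \<rat>"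
  shows "inf_image (morph_of [0,1] [0]) (char_word (1 - \<alpha> / (1 - \<alpha>))) (char_word \<alpha>)"
proof -
  let ?\<beta> = "\<alpha> / (1 - \<alpha>)"
  have "morph_of [0,1] [0] (prefix_word n (char_word (1 - ?\<beta>))) =
      morph_of [0] [0,1] (prefix_word n (char_word ?\<beta>))" for n
    by (induction n) (simp_all add: prefix_word_Suc morph_of_def char_word_complement[OF assms(3)],
      simp add: prefix_word_def)
  then show ?thesis using char_word_psi3[OF assms(1,2)] by (simp add: inf_image_def)
qed

section \<open>Quadratic equations with a negative conjugate root\<close>

text \<open>The triple \<open>(c, e, b)\<close> stands for the equation \<open>c y\<^sup>2 + e y = b\<close>. The condition
  \<open>c + e < b\<close> says that the positive root exceeds 1, and \<open>4 * c + 2 * e < b\<close> that it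
  exceeds 2.\<close>

definition quad_eqs :: "int \<Rightarrow> (int \<times> int \<times> int) set" where
  "quad_eqs D = {(c, e, b). c > 0 \<and> b > 0 \<and> e\<^sup>2 + 4 * b * c = D \<and> c + e < b}"

text \<open>Substituting \<open>y = z + 1\<close> gives the first triple, the equation of
  \<open>z\<close>. If the root is below 2, the second triple is the equation of
  \<open>1 / z\<close>.\<close>

fun quad_step :: "int \<times> int \<times> int \<Rightarrow> int \<times> int \<times> int" where
  "quad_step (c, e, b) =
    (if 4 * c + 2 * e < b then (c, e + 2 * c, b - c - e) else (b - c - e, - (e + 2 * c), c))"

fun quad_root :: "int \<times> int \<times> int \<Rightarrow> real \<Rightarrow> bool" where
  "quad_root (c, e, b) y \<longleftrightarrow> y > 0 \<and> of_int c * y\<^sup>2 + of_int e * y = of_int b"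

text \<open>Both summands of \<open>D\<close> are nonnegative, and \<open>b * c\<close> dominates
  \<open>b\<close> and \<open>c\<close> because these are positive integers.\<close>

lemma finite_quad_eqs: "finite (quad_eqs D)"
proof (rule finite_subset)
  show "quad_eqs D \<subseteq> {0..D} \<times> {-D..D} \<times> {0..D}"
  proof (clarsimp simp: quad_eqs_def)
    fix c e b :: int assume *: "0 < c" "0 < b" "c + e < b"
    have bc: "0 < b * c" "c \<le> b * c" "b \<le> b * c" using * by simp_all
    have "\<bar>e\<bar> \<le> \<bar>e\<bar>\<^sup>2" by (cases "e = 0") (use self_le_power[of "\<bar>e\<bar>" 2] in simp_all)
    then have "\<bar>e\<bar> \<le> e\<^sup>2" by simp
    moreover have "4 * b * c = 4 * (b * c)" by simp
    ultimately show "c \<le> e\<^sup>2 + 4 * b * c \<and> - e\<^sup>2 - 4 * b * c \<le> e \<and> e \<le> e\<^sup>2 + 4 * b * c \<and> b \<le> e\<^sup>2 + 4 * b * c"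
      using bc by linarith
  qed
qed auto

lemma quad_step_quad_eqs:
  assumes D: "\<And>k. k\<^sup>2 \<noteq> D" and p: "p \<in> quad_eqs D"
  shows "quad_step p \<in> quad_eqs D"
proof (cases p)
  case (fields c e b)
  with p have p': "c > 0" "b > 0" "e\<^sup>2 + 4 * b * c = D" "c + e < b" by (auto simp: quad_eqs_def)
  \<comment> \<open>Otherwise 2 would be a root and \<open>D\<close> a square. Excluding equality
    makes the last condition of \<open>quad_eqs\<close> strict in the second branch.\<close>
  have "4 * c + 2 * e \<noteq> b"
  proof
    assume "4 * c + 2 * e = b"
    then have "(e + 4 * c)\<^sup>2 = D" using p'(3) by (auto simp: power2_eq_square algebra_simps)
    with D show False by blast
  qed
  with p' show ?thesis by (auto simp: fields quad_eqs_def power2_eq_square algebra_simps)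
qed

text \<open>The sign of \<open>c - e - b\<close>, the value at \<open>-1\<close> of the quadratic polynomial, tells
  which branch was taken.\<close>
lemma inj_on_quad_step: "inj_on quad_step (quad_eqs D)"
  by (rule inj_onI) (auto simp: quad_eqs_def split: if_splits)

text \<open>An orbit in a finite set repeats, and the common initial iterate cancels by
  injectivity.\<close>

lemma finite_inj_on_periodic:
  assumes "finite S" "inj_on f S" "f ` S \<subseteq> S" "p \<in> S"
  shows "\<exists>n>0. (f ^^ n) p = p"
proof -
  have bij: "bij_betw f S S"
    using assms by (simp add: bij_betw_def endo_inj_surj)
  have in_S: "(f ^^ n) p \<in> S" for n using bij_betw_funpow[OF bij, of n] assms(4) by (auto simp: bij_betw_def)
  then have "\<not> inj (\<lambda>n. (f ^^ n) p)"
    using finite_imageD[of "\<lambda>n. (f ^^ n) p" UNIV] finite_subset[OF _ assms(1), of "range (\<lambda>n. (f ^^ n) p)"]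
    by auto
  then obtain i j where ij: "i < j" "(f ^^ i) p = (f ^^ j) p"
    unfolding inj_def by (metis linorder_neqE_nat)
  have "(f ^^ i) ((f ^^ (j - i)) p) = (f ^^ i) p"
    using ij funpow_add[of i "j - i" f] by simp
  then have "(f ^^ (j - i)) p = p"
    using bij_betw_funpow[OF bij, of i] in_S assms(4) by (auto simp: bij_betw_def inj_on_def)
  then show ?thesis using ij(1) by (intro exI[of _ "j - i"]) simp
qed

text \<open>Multiplied by \<open>y\<close> this quantity is \<open>b\<close>. For
  \<open>c > 0\<close> it is \<open>-c\<close> times the conjugate root, so the claim says that the
  conjugate is negative.\<close>

lemma quad_root_slope:
  assumes "quad_root (c, e, b) y" "b > 0"
  shows "of_int c * y + of_int e > 0"
proof -
  have "y * (of_int c * y + of_int e) > 0" using assms by (simp add: power2_eq_square algebra_simps)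
  then show ?thesis using assms by (simp add: zero_less_mult_iff)
qed

text \<open>The difference of the quadratic values at \<open>k\<close> and at \<open>y\<close> is
  \<open>k - y\<close> times a positive factor.\<close>

lemma quad_root_less_iff:
  fixes k :: int
  assumes "quad_root (c, e, b) y" "c > 0" "b > 0" "k > 0"
  shows "of_int k < y \<longleftrightarrow> c * k\<^sup>2 + e * k < b"
proof -
  have "of_int (c * k\<^sup>2 + e * k - b) = (of_int k - y) * (of_int c * of_int k + (of_int c * y + of_int e))"
    using assms(1) by (simp add: power2_eq_square algebra_simps)
  moreover have "of_int c * of_int k + (of_int c * y + of_int e) > 0"
    using quad_root_slope[OF assms(1,3)] assms by (simp add: add_pos_pos)
  ultimately have "of_int (c * k\<^sup>2 + e * k - b) < (0::real) \<longleftrightarrow> of_int k < y"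
    by (simp add: mult_less_0_iff)
  then show ?thesis unfolding of_int_less_0_iff diff_less_0_iff_less by blast
qed

lemma quad_root_unique:
  assumes "quad_root (c, e, b) y" "quad_root (c, e, b) z" "c > 0" "b > 0"
  shows "y = z"
proof -
  have "(y - z) * (of_int c * z + (of_int c * y + of_int e)) = 0"
    using assms(1,2) by (simp add: power2_eq_square algebra_simps)
  moreover have "of_int c * z + (of_int c * y + of_int e) > 0"
    using quad_root_slope[OF assms(1,4)] assms(2,3) by (simp add: add_pos_pos)
  ultimately show ?thesis by simp
qed

text \<open>For \<open>\<alpha> = 1 / (y + 1)\<close> the quotient
  \<open>\<alpha> / (1 - \<alpha>)\<close> is \<open>1 / y\<close>. The two cases pass to the slopes
  \<open>1 / y\<close> and \<open>1 - 1 / y\<close>, as in the two desubstitutions.\<close>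

definition root_step :: "real \<Rightarrow> real" where
  "root_step y = (if y > 2 then y - 1 else 1 / (y - 1))"

lemma quad_root_step:
  assumes p: "p \<in> quad_eqs D" and y: "quad_root p y"
  shows "quad_root (quad_step p) (root_step y)"
proof (cases p)
  case (fields c e b)
  with p have p': "c > 0" "b > 0" "c + e < b" by (auto simp: quad_eqs_def)
  note y' = y[unfolded fields]
  have y1: "y > 1" using quad_root_less_iff[OF y' p'(1,2), of 1] p' by simp
  have y2: "y > 2 \<longleftrightarrow> 4 * c + 2 * e < b"
    using quad_root_less_iff[OF y' p'(1,2), of 2] by (simp add: mult.commute)
  have eq: "of_int c * (y - 1)\<^sup>2 + of_int (e + 2 * c) * (y - 1) = of_int (b - c - e)"
    using y' by (simp add: power2_eq_square algebra_simps)
  show ?thesis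
  proof (cases "y > 2")
    case True
    then show ?thesis using y1 y2 eq by (simp add: fields root_step_def)
  next
    case False
    \<comment> \<open>With \<open>z = y - 1\<close>, dividing the equation by the square of
      \<open>z\<close> reverses its coefficients.\<close>
    have inv: "(C * z\<^sup>2 + E * z) * (1 / z)\<^sup>2 + - E * (1 / z) = C" if "z \<noteq> 0" for C E z :: real
      using that by (simp add: field_simps power2_eq_square)
    have "of_int (b - c - e) * (1 / (y - 1))\<^sup>2 + of_int (- (e + 2 * c)) * (1 / (y - 1)) = of_int c"
      unfolding eq[symmetric] of_int_minus by (rule inv) (use y1 in simp)
    with False show ?thesis using y1 y2 by (simp add: fields root_step_def)
  qed
qed

section \<open>A period of desubstitutions\<close>

lemma M24_nonerasing: "\<psi> \<in> M24 \<Longrightarrow> w \<noteq> [] \<Longrightarrow> \<psi> w \<noteq> []"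
proof (induction arbitrary: w rule: M24.induct)
  case 2
  then show ?case by (cases w) (auto simp: psi2_def morph_of_def)
next
  case 3
  then show ?case by (cases w) (auto simp: psi4_def morph_of_def)
qed simp_all

text \<open>This is the test for leaving \<open>M4\<close>: an image of the letter 0 longer than one
  letter suffices.\<close>

lemma M4_0: "\<psi> \<in> M4 \<Longrightarrow> \<psi> [0] = [0]"
proof -
  have "(psi4 ^^ n) [0] = [0]" for n by (induction n) (simp_all add: psi4_def morph_of_def)
  then show "\<psi> \<in> M4 \<Longrightarrow> \<psi> [0] = [0]" by (auto simp: M4_def)
qed

lemma char_word_root_step:
  assumes y: "y > 1" "y \<notin> \<rat>"
  shows "inf_image (time_reversal (if y > 2 then psi4 else psi2))
    (char_word (1 / (root_step y + 1))) (char_word (1 / (y + 1)))"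
proof -
  let ?\<alpha> = "1 / (y + 1)"
  have \<alpha>: "0 < ?\<alpha>" "?\<alpha> < 1/2" using y by (simp_all add: field_simps)
  have \<beta>: "?\<alpha> / (1 - ?\<alpha>) = 1 / y" using y by (simp add: field_simps)
  have "1 / y \<notin> \<rat>" using y(2) Rats_inverse[of "1 / y"] by (auto simp: inverse_eq_divide)
  moreover have "1 / (1 / (y - 1) + 1) = 1 - 1 / y" using y by (simp add: field_simps)
  ultimately show ?thesis
    using char_word_psi3[OF \<alpha>, unfolded \<beta>] char_word_psi1[OF \<alpha>, unfolded \<beta>]
    by (simp add: root_step_def time_reversal_psi2 time_reversal_psi4)
qed

text \<open>The second conjunct says that an image of 0 of length 1 forces all factors to be
  \<open>psi4\<close>, hence all steps to be subtractions of 1.\<close>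

lemma char_word_iterated_root_step:
  assumes "\<And>m. (root_step ^^ m) y > 1" "\<And>m. (root_step ^^ m) y \<notin> \<rat>"
  shows "\<exists>\<psi>\<in>M24. inf_image (time_reversal \<psi>) (char_word (1 / ((root_step ^^ n) y + 1))) (char_word (1 / (y + 1)))
    \<and> (length (\<psi> [0]) = 1 \<longrightarrow> (root_step ^^ n) y = y - real n)"
proof (induction n)
  case 0
  have "inf_image id x x" for x by (rule inf_imageI_prefix[of id x "\<lambda>n. n"]) simp_all
  then have "inf_image (time_reversal id) x x" for x by (simp only: time_reversal_id)
  then show ?case by (intro bexI[OF _ M24.intros(1)]) (simp only: funpow_0 of_nat_0 diff_zero simp_thms)
next
  case (Suc n)
  then obtain \<psi> where \<psi>: "\<psi> \<in> M24"
    "inf_image (time_reversal \<psi>) (char_word (1 / ((root_step ^^ n) y + 1))) (char_word (1 / (y + 1)))"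
    "length (\<psi> [0]) = 1 \<longrightarrow> (root_step ^^ n) y = y - real n" by blast
  let ?z = "(root_step ^^ n) y"
  let ?g = "if ?z > 2 then psi4 else psi2"
  have g: "?g \<in> M24" by (simp add: M24.intros)
  have "inf_image (time_reversal (\<psi> \<circ> ?g)) (char_word (1 / ((root_step ^^ Suc n) y + 1))) (char_word (1 / (y + 1)))"
    using inf_image_comp[OF morphism_time_reversal \<psi>(2) char_word_root_step[of ?z]] assms[of n]
      time_reversal_comp[OF \<psi>(1)[THEN M24_morphism] g[THEN M24_morphism]]
    by simp
  moreover have "length ((\<psi> \<circ> ?g) [0]) = 1 \<longrightarrow> (root_step ^^ Suc n) y = y - real (Suc n)"
  proof (cases "?z > 2")
    case True
    then have "root_step ?z = ?z - 1" "?g [0] = [0]" by (simp_all add: root_step_def psi4_def morph_of_def)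
    then show ?thesis using \<psi>(3) by (auto simp del: One_nat_def)
  next
    case False
    \<comment> \<open>A factor \<open>psi2\<close> makes the image of 0 a product of two nonempty
      words, so the implication holds vacuously.\<close>
    have "psi2 [0] = [1] @ [0]" by (simp add: psi2_def morph_of_def)
    then have "(\<psi> \<circ> ?g) [0] = \<psi> [1] @ \<psi> [0]"
      using False morphism_append[OF \<psi>(1)[THEN M24_morphism], of "[1]" "[0]"] by simp
    moreover have "length (\<psi> [1]) > 0" "length (\<psi> [0]) > 0" using M24_nonerasing[OF \<psi>(1)] by simp_all
    ultimately have "length ((\<psi> \<circ> ?g) [0]) \<noteq> 1" unfolding \<open>(\<psi> \<circ> ?g) [0] = \<psi> [1] @ \<psi> [0]\<close> length_append by linarith
    then show ?thesis by blast
  qed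
  ultimately show ?case using M24.intros(4)[OF \<psi>(1) g] by blast
qed

lemma ex_M24_fixing_char_word:
  assumes y: "y > 1" "y \<notin> \<rat>" "quad_root (c, e, b) y" and cb: "c > 0" "b > 0"
  shows "\<exists>\<psi>\<in>M24 - M4. fixed_point (time_reversal \<psi>) (char_word (1 / (y + 1)))"
proof -
  define D where "D = e\<^sup>2 + 4 * b * c"
  let ?p = "(c, e, b)"
  \<comment> \<open>\<open>2 * c * y + e\<close> is a square root of \<open>D\<close>; if
    \<open>D\<close> were a square, \<open>y\<close> would be rational.\<close>
  have D: "k\<^sup>2 \<noteq> D" for k
  proof
    assume k: "k\<^sup>2 = D"
    have "(2 * of_int c * y + of_int e)\<^sup>2 = 4 * of_int c * (of_int c * y\<^sup>2 + of_int e * y) + (of_int e)\<^sup>2"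
      by (simp add: power2_eq_square algebra_simps)
    also have "\<dots> = of_int D" using y(3) by (simp add: D_def)
    also have "\<dots> = (of_int k)\<^sup>2" using k by (metis of_int_power)
    finally have "2 * of_int c * y + of_int e = of_int k \<or> 2 * of_int c * y + of_int e = - of_int k"
      by (simp add: power2_eq_iff)
    then have "y = of_int (k - e) / of_int (2 * c) \<or> y = of_int (- k - e) / of_int (2 * c)"
      using cb(1) by (auto simp: field_simps)
    then show False using y(2) by (metis Rats_divide Rats_of_int)
  qed
  have p: "?p \<in> quad_eqs D"
    using quad_root_less_iff[OF y(3) cb, of 1] cb y(1) by (simp add: quad_eqs_def D_def)
  have orbit: "(quad_step ^^ n) ?p \<in> quad_eqs D \<and> quad_root ((quad_step ^^ n) ?p) ((root_step ^^ n) y)" for n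
  proof (induction n)
    case (Suc n)
    then show ?case using quad_step_quad_eqs[OF D] quad_root_step[of "(quad_step ^^ n) ?p" D]
      by (simp del: quad_step.simps quad_root.simps)
  qed (use p y(3) in simp)
  have gt1: "(root_step ^^ n) y > 1" for n
  proof -
    obtain c' e' b' where q: "(quad_step ^^ n) ?p = (c', e', b')" by (cases "(quad_step ^^ n) ?p")
    show ?thesis
      using orbit[of n] quad_root_less_iff[of c' e' b' "(root_step ^^ n) y" 1]
      unfolding q by (auto simp: quad_eqs_def)
  qed
  have irr: "(root_step ^^ n) y \<notin> \<rat>" for n
  proof (induction n)
    case (Suc n)
    let ?z = "(root_step ^^ n) y"
    \<comment> \<open>Both branches are inverted by rational operations, so irrationality
      persists.\<close>
    have "?z = root_step ?z + 1 \<or> ?z = 1 / root_step ?z + 1" using gt1[of n] by (simp add: root_step_def)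
    then have "root_step ?z \<in> \<rat> \<Longrightarrow> ?z \<in> \<rat>" by (metis Rats_1 Rats_add Rats_divide)
    with Suc show ?case by auto
  qed (use y in simp)
  obtain n where n: "n > 0" "(quad_step ^^ n) ?p = ?p"
    using finite_inj_on_periodic[OF finite_quad_eqs inj_on_quad_step _ p] quad_step_quad_eqs[OF D] by blast
  \<comment> \<open>An equation determines its positive root, so a period of the equations is one of
    the roots.\<close>
  have per: "(root_step ^^ n) y = y" using quad_root_unique[OF _ y(3) cb] orbit[of n] n(2) by metis
  obtain \<psi> where \<psi>: "\<psi> \<in> M24" "inf_image (time_reversal \<psi>) (char_word (1 / (y + 1))) (char_word (1 / (y + 1)))"
    "length (\<psi> [0]) = 1 \<longrightarrow> y = y - real n"
    using char_word_iterated_root_step[of y n, OF gt1 irr] per by auto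
  \<comment> \<open>A period of subtractions alone would give \<open>y = y - n\<close> with
    \<open>n > 0\<close>.\<close>
  have "\<psi> \<notin> M4" using \<psi>(3) n(1) M4_0 by fastforce
  with \<psi> show ?thesis by (auto simp: fixed_point_def)
qed

section \<open>The incidence matrix of a substitution fixing a Sturmian word\<close>

lemma bit_cases: "(a::bit) = 0 \<or> a = 1"
  by (cases a) simp_all

lemma count_list_morphism:
  assumes "morphism \<sigma>"
  shows "count_list (\<sigma> w) x = count_list w 0 * count_list (\<sigma> [0]) x + count_list w 1 * count_list (\<sigma> [1]) x"
proof (induction w)
  case Nil
  then show ?case using assms by (simp add: morphism_Nil)
next
  case (Cons a w)
  have "count_list (\<sigma> (a # w)) x = count_list (\<sigma> [a]) x + count_list (\<sigma> w) x"
    by (subst morphism_Cons[OF assms]) simp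
  then show ?case using Cons bit_cases[of a] by auto
qed

lemma length_count_list_bit: "length (w :: word) = count_list w 0 + count_list w 1"
proof (induction w)
  case (Cons a w)
  then show ?case using bit_cases[of a] by auto
qed simp

lemma count_list_sturm:
  assumes "0 < \<alpha>" "\<alpha> < 1"
  shows "int (count_list (prefix_word n (sturm \<alpha> \<rho>)) 1) = \<lfloor>real n * \<alpha> + \<rho>\<rfloor> - \<lfloor>\<rho>\<rfloor>"
proof (induction n)
  case 0
  then show ?case by (simp add: prefix_word_def)
next
  case (Suc n)
  then show ?case using sturm_letter[OF assms, of n \<rho>]
    by (simp add: prefix_word_Suc add.commute split: if_splits)
qed

lemma bounded_multiples_zero:
  fixes t K :: real
  assumes "\<And>n::nat. \<bar>real n * t\<bar> \<le> K"
  shows "t = 0"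
proof (rule ccontr)
  assume "t \<noteq> 0"
  then obtain n where "K < real n * \<bar>t\<bar>" using reals_Archimedean3[of "\<bar>t\<bar>"] by auto
  with assms[of n] show False by (simp add: abs_mult)
qed

text \<open>The letter 1 has frequency \<alpha> both in the word and in its image, which is the same
  word. Applying the incidence matrix to the frequency vector
  \<open>(1 - \<alpha>, \<alpha>)\<close> gives the identity.\<close>

lemma sturm_incidence:
  assumes \<alpha>: "0 < \<alpha>" "\<alpha> < 1" and \<sigma>: "morphism \<sigma>" "fixed_point \<sigma> (sturm \<alpha> \<rho>)"
  defines "a \<equiv> real (count_list (\<sigma> [0]) 0)" and "b \<equiv> real (count_list (\<sigma> [1]) 0)"
    and "c \<equiv> real (count_list (\<sigma> [0]) 1)" and "d \<equiv> real (count_list (\<sigma> [1]) 1)"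
  shows "c * (1 - \<alpha>) + d * \<alpha> = \<alpha> * ((a + c) * (1 - \<alpha>) + (b + d) * \<alpha>)"
proof -
  let ?s = "sturm \<alpha> \<rho>"
  let ?t = "c * (1 - \<alpha>) + d * \<alpha> - \<alpha> * ((a + c) * (1 - \<alpha>) + (b + d) * \<alpha>)"
  let ?m = "d - c - \<alpha> * (b + d - a - c)"
  have near: "\<bar>real (count_list (prefix_word n ?s) 1) - real n * \<alpha>\<bar> \<le> 1" for n
  proof -
    have "real (count_list (prefix_word n ?s) 1) = of_int (\<lfloor>real n * \<alpha> + \<rho>\<rfloor> - \<lfloor>\<rho>\<rfloor>)"
      using count_list_sturm[OF \<alpha>, of n \<rho>] by (metis of_int_of_nat_eq)
    then show ?thesis by simp linarith
  qed
  have "\<bar>real n * ?t\<bar> \<le> 1 + \<bar>?m\<bar>" for n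
  proof -
    let ?w = "prefix_word n ?s"
    define k where "k = real (count_list ?w 1)"
    define L where "L = length (\<sigma> ?w)"
    have k0: "real (count_list ?w 0) = real n - k"
      using length_count_list_bit[of ?w] by (simp add: k_def)
    have im: "\<sigma> ?w = prefix_word L ?s"
      using inf_image_prefix_word \<sigma> by (simp add: fixed_point_def L_def)
    have K: "real (count_list (\<sigma> ?w) 1) = c * (real n - k) + d * k"
      using count_list_morphism[OF \<sigma>(1), of ?w 1] k0 by (simp add: c_def d_def k_def)
    have "real (count_list (\<sigma> ?w) 0) = a * (real n - k) + b * k"
      using count_list_morphism[OF \<sigma>(1), of ?w 0] k0 by (simp add: a_def b_def k_def)
    with K have L: "real L = (a + c) * (real n - k) + (b + d) * k"
      using length_count_list_bit[of "\<sigma> ?w"] by (simp add: L_def algebra_simps)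
    \<comment> \<open>The error of the image prefix splits into \<open>n * ?t\<close> and
      \<open>?m\<close> times the error of the prefix. Both errors are at most 1 in absolute value,
      so \<open>n * ?t\<close> stays bounded.\<close>
    have "real n * ?t = (real (count_list (\<sigma> ?w) 1) - real L * \<alpha>) - (k - real n * \<alpha>) * ?m"
      unfolding K L by (simp add: algebra_simps)
    moreover have "\<bar>real (count_list (\<sigma> ?w) 1) - real L * \<alpha>\<bar> \<le> 1" unfolding im by (rule near)
    moreover have "\<bar>(k - real n * \<alpha>) * ?m\<bar> \<le> \<bar>?m\<bar>"
      using near[of n] mult_right_mono[of "\<bar>k - real n * \<alpha>\<bar>" 1 "\<bar>?m\<bar>"] by (simp add: abs_mult k_def)
    ultimately show ?thesis by linarith
  qed
  then have "?t = 0" by (rule bounded_multiples_zero)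
  then show ?thesis by simp
qed

lemma count_list_eq_0_replicate:
  "count_list (w :: word) 1 = 0 \<Longrightarrow> w = replicate (count_list w 0) 0"
  "count_list (w :: word) 0 = 0 \<Longrightarrow> w = replicate (count_list w 1) 1"
proof (induction w)
  case (Cons a w)
  { case 1 then show ?case using Cons bit_cases[of a] by (auto split: if_splits) }
  { case 2 then show ?case using Cons bit_cases[of a] by (auto split: if_splits) }
qed simp_all

lemma morphism_eq_id:
  assumes "morphism \<sigma>" "\<sigma> [0] = [0]" "\<sigma> [1] = [1]"
  shows "\<sigma> = id"
proof
  show "\<sigma> w = id w" for w
  proof (induction w)
    case (Cons a w)
    then show ?case using morphism_Cons[OF assms(1), of a w] assms bit_cases[of a] by auto
  qed (simp add: morphism_Nil assms)
qed

text \<open>If both off-diagonal entries of the incidence matrix vanish, the matrix is scalar. A scalar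
  other than 1 is impossible since \<open>11\<close> is not a prefix of the word.\<close>
lemma substitution_invariant_quad_root:
  assumes \<alpha>: "0 < \<alpha>" "\<alpha> < 1/2" "\<alpha> \<notin> \<rat>"
    and inv: "substitution_invariant (sturm \<alpha> (1 - \<alpha>))"
  shows "\<exists>c e b. quad_root (c, e, b) ((1 - \<alpha>) / \<alpha>) \<and> c > 0 \<and> b > 0"
proof -
  let ?s = "sturm \<alpha> (1 - \<alpha>)"
  obtain \<sigma> where \<sigma>: "morphism \<sigma>" "\<sigma> \<noteq> id" "fixed_point \<sigma> ?s"
    using inv by (auto simp: substitution_invariant_def)
  define a where "a = int (count_list (\<sigma> [0]) 0)"
  define b where "b = int (count_list (\<sigma> [1]) 0)"
  define c where "c = int (count_list (\<sigma> [0]) 1)"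
  define d where "d = int (count_list (\<sigma> [1]) 1)"
  define y where "y = (1 - \<alpha>) / \<alpha>"
  have y0: "y > 0" using \<alpha> by (simp add: y_def)
  have \<alpha>y: "\<alpha> = 1 / (y + 1)" using \<alpha> by (simp add: y_def field_simps)
  have y: "y \<notin> \<rat>" using \<alpha>(3) unfolding \<alpha>y by (metis Rats_1 Rats_add Rats_divide)
  have "c * (1 - \<alpha>) + d * \<alpha> = \<alpha> * ((a + c) * (1 - \<alpha>) + (b + d) * \<alpha>)"
    using sturm_incidence[of \<alpha> \<sigma> "1 - \<alpha>"] \<alpha> \<sigma> by (simp add: a_def b_def c_def d_def)
  then have "c * (1 - \<alpha>)\<^sup>2 + (d - a) * (\<alpha> * (1 - \<alpha>)) = b * \<alpha>\<^sup>2"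
    by (simp add: power2_eq_square algebra_simps)
  moreover have "1 - \<alpha> = \<alpha> * y" using \<alpha> by (simp add: y_def)
  ultimately have "\<alpha>\<^sup>2 * (of_int c * y\<^sup>2 + of_int (d - a) * y) = \<alpha>\<^sup>2 * of_int b"
    by (simp add: power_mult_distrib power2_eq_square algebra_simps)
  then have eq: "of_int c * y\<^sup>2 + of_int (d - a) * y = of_int b" using \<alpha>(1) by simp
  have nn: "a \<ge> 0" "b \<ge> 0" "c \<ge> 0" "d \<ge> 0" by (simp_all add: a_def b_def c_def d_def)
  have "c > 0 \<and> b > 0"
  proof (rule ccontr)
    assume "\<not> (c > 0 \<and> b > 0)"
    with nn consider "c = 0" | "c \<noteq> 0" "b = 0" by linarith
    \<comment> \<open>If an off-diagonal entry vanishes, the equation becomes linear, after division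
      by \<open>y\<close> when \<open>b = 0\<close>. Irrationality of \<open>y\<close> then forces
      all its coefficients to be 0.\<close>
    then have "c = 0 \<and> b = 0 \<and> d = a"
    proof cases
      case 1
      have "d = a"
      proof (rule ccontr)
        assume "d \<noteq> a"
        with 1 eq have "y = of_int b / of_int (d - a)" by (simp add: field_simps)
        then show False using y by (metis Rats_divide Rats_of_int)
      qed
      with 1 eq show ?thesis by simp
    next
      case 2
      with eq y0 have "of_int c * y = of_int (a - d)"
        by (simp add: power2_eq_square algebra_simps)
          (metis add_diff_cancel_left' distrib_left mult_cancel_left mult.left_commute mult.commute less_irrefl)
      then have "y = of_int (a - d) / of_int c" using 2 by (simp add: field_simps)
      then show ?thesis using y by (metis Rats_divide Rats_of_int)
    qed
    then have cnt: "count_list (\<sigma> [0]) 1 = 0" "count_list (\<sigma> [1]) 0 = 0"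
      "count_list (\<sigma> [1]) 1 = nat a" "count_list (\<sigma> [0]) 0 = nat a"
      by (simp_all add: a_def b_def c_def d_def)
    have img: "\<sigma> [0] = replicate (nat a) 0" "\<sigma> [1] = replicate (nat a) 1"
      using count_list_eq_0_replicate(1)[OF cnt(1)] count_list_eq_0_replicate(2)[OF cnt(2)] cnt(3,4) by simp_all
    \<comment> \<open>The word starts with \<open>10\<close>, so the prefix \<sigma>(1), a power of
      1, has length at most 1. Length 1 makes \<sigma> the identity; length 0 makes it erase
      everything, so it has no infinite fixed point.\<close>
    have s01: "?s 0 = 1" "?s 1 = 0" using \<alpha> by (simp_all add: sturm_lozenge prepend2_def)
    have "\<sigma> [1] = prefix_word (nat a) ?s"
      using inf_image_prefix_word[OF \<sigma>(1) \<sigma>(3)[unfolded fixed_point_def], of 1] s01 img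
      by (simp add: prefix_word_def)
    then have "replicate (nat a) 1 ! 1 = prefix_word (nat a) ?s ! 1" unfolding img by (rule arg_cong)
    then have "\<not> nat a > 1" using s01(2) by (cases "nat a > 1") simp_all
    moreover have "nat a \<noteq> 1" using morphism_eq_id[OF \<sigma>(1)] \<sigma>(2) img by auto
    ultimately have "\<sigma> [0] = []" "\<sigma> [1] = []" using img by simp_all
    then have "\<sigma> w = []" for w
    proof (induction w)
      case (Cons x w)
      then show ?case using morphism_Cons[OF \<sigma>(1), of x w] bit_cases[of x] by auto
    qed (simp add: morphism_Nil \<sigma>)
    then show False using \<sigma>(3) by (auto simp: fixed_point_def inf_image_def prefix_word_def dest: spec[of _ 1])
  qed
  with eq y0 show ?thesis unfolding y_def[symmetric] by (intro exI[of _ c] exI[of _ "d - a"] exI[of _ b]) simp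
qed

theorem theorem2:
  fixes \<alpha> \<rho> :: real
  assumes "0 < \<alpha>" and "\<alpha> < 1/2" and "\<alpha> \<notin> \<rat>" and "\<rho> = 1 - \<alpha>"
    and "substitution_invariant (sturm \<alpha> \<rho>)"
    and "substitution_invariant (sturm' \<alpha> \<rho>)"
  shows "(\<exists>\<psi> \<in> M24 - M4. fixed_point (time_reversal \<psi>) (char_word \<alpha>) \<and>
            fixed_point (\<psi> ^^ 2) (sturm \<alpha> \<rho>) \<and> fixed_point (\<psi> ^^ 2) (sturm' \<alpha> \<rho>))
       \<and> (\<forall>\<psi> \<in> M24 - M4. fixed_point (time_reversal \<psi>) (char_word \<alpha>) \<longrightarrow>
            fixed_point (\<psi> ^^ 2) (sturm \<alpha> \<rho>) \<and> fixed_point (\<psi> ^^ 2) (sturm' \<alpha> \<rho>))"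
proof -
  have s: "sturm \<alpha> \<rho> = prepend2 1 0 (char_word \<alpha>)" "sturm' \<alpha> \<rho> = prepend2 0 1 (char_word \<alpha>)"
    using assms sturm_lozenge sturm'_lozenge by simp_all
  have all: "\<forall>\<psi> \<in> M24 - M4. fixed_point (time_reversal \<psi>) (char_word \<alpha>) \<longrightarrow>
      fixed_point (\<psi> ^^ 2) (sturm \<alpha> \<rho>) \<and> fixed_point (\<psi> ^^ 2) (sturm' \<alpha> \<rho>)"
    unfolding s using M24_square_fixed_point by blast
  \<comment> \<open>\<open>?y\<close> is the ratio of the frequencies of 0 and 1; the bound
    \<open>\<alpha> < 1/2\<close> becomes \<open>?y > 1\<close>.\<close>
  let ?y = "(1 - \<alpha>) / \<alpha>"
  have \<alpha>y: "1 / (?y + 1) = \<alpha>" using assms(1) by (simp add: field_simps)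
  have y: "?y > 1" using assms(1,2) by (simp add: field_simps)
  have "?y \<notin> \<rat>" using assms(3) \<alpha>y by (metis Rats_1 Rats_add Rats_divide)
  moreover obtain c e b where "quad_root (c, e, b) ?y" "c > 0" "b > 0"
    using substitution_invariant_quad_root assms by blast
  ultimately have "\<exists>\<psi>\<in>M24 - M4. fixed_point (time_reversal \<psi>) (char_word \<alpha>)"
    using ex_M24_fixing_char_word[of ?y c e b] y unfolding \<alpha>y by blast
  with all show ?thesis by blast
qed

end
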